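(* Let $h_t\in\mathbb{R}^M$, $t\ge 0$, be the solution of $$\frac{d h_t}{dt}=A(\hat Y-h_t),\qquad h_0=\mathcal{G},$$ where $A\in\mathbb{R}^{M\times M}$, $\hat Y\in\mathbb{R}^M$ and the Gaussian random vector $\mathcal{G}\in\mathbb{R}^M$ are as defined in the context. If $A$ is positive definite, then $h_t\to\hat Y$ as $t\to\infty$.
   Context: Let $(x^{(i)},y^{(i)})_{i=1}^M\subset\mathbb{R}^d\times\mathbb{R}$ be a fixed dataset and $\hat Y=(y^{(1)},\dots,y^{(M)})$. Let $\sigma\in C^2_b(\mathbb{R})$ (twice continuously differentiable, bounded with bounded derivatives), $\alpha>0$ a constant, and $\mu_0(dc,dw)$ a probability measure on $\mathbb{R}\times\mathbb{R}^d$ of mean zero whose $c$-marginal has compact support and with $\int\|w\|\,d\mu_0<\infty$. Write $\langle f,\mu_0\rangle=\int f(c,w)\,\mu_0(dc,dw)$. The symmetric matrix $A$ has entries, for $i,j=1,\dots,M$ and $x=x^{(i)}$, $x'=x^{(j)}$, $$A_{ij}=\frac{\alpha}{M}\langle\sigma(w\cdot x)\sigma(w\cdot x'),\mu_0\rangle+\frac{\alpha}{M}\langle c^2\sigma'(w\cdot x')\sigma'(w\cdot x)\,x\cdot x',\mu_0\rangle .$$ $\mathcal{G}\in\mathbb{R}^M$ is a Gaussian random vector, namely the limit in distribution as $N\to\infty$ of $\big(\frac{1}{\sqrt N}\sum_{i=1}^N C^i_0\sigma(W^i_0\cdot x^{(j)})\big)_{j=1}^M$ with $(C_0^i,W_0^i)$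 i.i.d. from $\mu_0$, where $C_0^i$ is independent of $W_0^i$. The convergence $h_t\to\hat Y$ is for each realization of $\mathcal{G}$. *)

theory Defs
  imports "HOL-Probability.Probability"
begin

definition C2_bounded :: "(real \<Rightarrow> real) \<Rightarrow> bool" where
  "C2_bounded f \<longleftrightarrow>
     f differentiable_on UNIV \<and> deriv f differentiable_on UNIV \<and>
     continuous_on UNIV (deriv (deriv f)) \<and>
     bounded (range f) \<and> bounded (range (deriv f)) \<and> bounded (range (deriv (deriv f)))"

definition measure_support :: "'a::topological_space measure \<Rightarrow> 'a set" where
  "measure_support m = {x. \<forall>U. open U \<and> x \<in> U \<longrightarrow> emeasure m U > 0}"

(* Weak convergence of Borel measures, tested on bounded continuous functions;
   weak_conv_m of the library covers the real line only. *)
definition weakly_converges ::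
    "(nat \<Rightarrow> 'a::topological_space measure) \<Rightarrow> 'a measure \<Rightarrow> bool" where
  "weakly_converges ms m \<longleftrightarrow>
     (\<forall>f :: 'a \<Rightarrow> real. continuous_on UNIV f \<and> bounded (range f) \<longrightarrow>
        (\<lambda>n. \<integral>z. f z \<partial>ms n) \<longlonglongrightarrow> (\<integral>z. f z \<partial>m))"

(* Every one-dimensional projection is normal; the second disjunct is the degenerate
   normal law of variance 0, so singular covariance matrices are allowed. *)
definition gaussian_vector :: "'w measure \<Rightarrow> ('w \<Rightarrow> 'a::euclidean_space) \<Rightarrow> bool" where
  "gaussian_vector P X \<longleftrightarrow>
     X \<in> borel_measurable P \<and>
     (\<forall>v. (\<exists>m s. s > 0 \<and> distributed P lborel (\<lambda>\<omega>. v \<bullet> X \<omega>) (normal_density m s)) \<or>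
          (\<exists>m. AE \<omega> in P. v \<bullet> X \<omega> = m))"

(* Independence of the generated sigma-algebras; indep_var of the library requires both
   variables to have the same value type. *)
definition independent_variables ::
    "'q measure \<Rightarrow> ('q \<Rightarrow> 'a::topological_space) \<Rightarrow> ('q \<Rightarrow> 'b::topological_space) \<Rightarrow> bool" where
  "independent_variables Q X Y \<longleftrightarrow>
     X \<in> borel_measurable Q \<and> Y \<in> borel_measurable Q \<and>
     prob_space.indep_set Q (sets (vimage_algebra (space Q) X borel))
                            (sets (vimage_algebra (space Q) Y borel))"

(* Symmetry is not included: the predicate is applied only to kernel_matrix,
   which is symmetric (kernel_matrix_symmetric). *)
definition positive_definite :: "real^'m^'m \<Rightarrow> bool" where
  "positive_definite B \<longleftrightarrow> (\<forall>v. v \<noteq> 0 \<longrightarrow> v \<bullet> (B *v v) > 0)"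

definition kernel_matrix ::
    "real \<Rightarrow> (real \<Rightarrow> real) \<Rightarrow> (real \<times> (real^'d)) measure \<Rightarrow> ('m::finite \<Rightarrow> real^'d) \<Rightarrow> real^'m^'m" where
  "kernel_matrix \<alpha> \<sigma> \<mu>0 x = (\<chi> i j.
     \<alpha> / real CARD('m) * (\<integral>(c, w). \<sigma> (w \<bullet> x i) * \<sigma> (w \<bullet> x j) \<partial>\<mu>0) +
     \<alpha> / real CARD('m) *
       (\<integral>(c, w). c\<^sup>2 * deriv \<sigma> (w \<bullet> x j) * deriv \<sigma> (w \<bullet> x i) * (x i \<bullet> x j) \<partial>\<mu>0))"

lemma kernel_matrix_symmetric: "transpose (kernel_matrix \<alpha> \<sigma> \<mu>0 x) = kernel_matrix \<alpha> \<sigma> \<mu>0 x"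
  by (simp add: kernel_matrix_def transpose_def vec_eq_iff inner_commute mult_ac)

definition initial_output ::
    "(real \<Rightarrow> real) \<Rightarrow> ('m::finite \<Rightarrow> real^'d) \<Rightarrow> (nat \<Rightarrow> 'q \<Rightarrow> real) \<Rightarrow> (nat \<Rightarrow> 'q \<Rightarrow> real^'d) \<Rightarrow>
     nat \<Rightarrow> 'q \<Rightarrow> real^'m" where
  "initial_output \<sigma> x C W N = (\<lambda>q. \<chi> j.
     1 / sqrt (real N) * (\<Sum>i<N. C i q * \<sigma> (W i q \<bullet> x j)))"

end

theory Submission
  imports Defs "HOL-Real_Asymp.Real_Asymp"
begin

text \<open>
  A positive definite \<open>A\<close> is coercive, \<open>v \<bullet> A v \<ge> c |v|\<^sup>2\<close> with \<open>c > 0\<close>,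
  by compactness of the unit sphere. Along the flow this gives
  \<open>d/dt |h - Yhat|\<^sup>2 \<le> - 2 c |h - Yhat|\<^sup>2\<close>, so the error decays exponentially from any
  initial value.
\<close>

lemma positive_definite_coercive:
  fixes B :: "real^'m^'m"
  assumes "positive_definite B"
  obtains c where "c > 0" "\<And>v. c * (norm v)\<^sup>2 \<le> v \<bullet> (B *v v)"
proof -
  let ?q = "\<lambda>v. v \<bullet> (B *v v)"
  have "continuous_on (sphere 0 1) ?q"
    by (intro continuous_intros linear_continuous_on matrix_vector_mul_bounded_linear)
  moreover have "sphere (0 :: real^'m) 1 \<noteq> {}"
    by simp
  ultimately have "\<exists>u\<in>sphere 0 1. \<forall>v\<in>sphere 0 1. ?q u \<le> ?q v"
    by (intro continuous_attains_inf compact_sphere)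
  then obtain u where u: "norm u = 1" and min: "\<And>v. norm v = 1 \<Longrightarrow> ?q u \<le> ?q v"
    by auto
  have "u \<noteq> 0"
    using u by force
  \<comment> \<open>The minimum over the unit sphere serves as the coercivity constant. It is
    positive because it is attained, at a nonzero vector.\<close>
  then have "?q u > 0"
    using assms by (simp add: positive_definite_def)
  moreover have "?q u * (norm v)\<^sup>2 \<le> ?q v" for v
  proof (cases "v = 0")
    case False
    \<comment> \<open>The quadratic form is homogeneous of degree 2, so the bound on unit vectors
      scales to every nonzero \<open>v\<close>.\<close>
    have "?q v = (norm v)\<^sup>2 * ?q (v /\<^sub>R norm v)"
      using False by (simp add: matrix_vector_mult_scaleR power2_eq_square field_simps)
    moreover have "?q u \<le> ?q (v /\<^sub>R norm v)"
      using False by (intro min) simp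
    ultimately show ?thesis
      by (metis mult.commute mult_left_mono zero_le_power2)
  qed simp
  ultimately show thesis
    by (rule that)
qed

text \<open>A Gronwall estimate by an integrating factor: the dissipation inequality says that the
  squared norm has derivative at most \<open>- 2 * c\<close> times itself, so multiplying it by
  \<open>exp (2 * c * t)\<close> gives a nonincreasing function.\<close>

lemma dissipative_flow_norm_le:
  fixes e e' :: "real \<Rightarrow> 'a::real_inner"
  assumes deriv: "\<And>t. t \<ge> 0 \<Longrightarrow> (e has_vector_derivative e' t) (at t within {0..})"
    and dissipative: "\<And>t. t \<ge> 0 \<Longrightarrow> e t \<bullet> e' t \<le> - c * (norm (e t))\<^sup>2"
    and "t \<ge> 0"
  shows "norm (e t) \<le> exp (- c * t) * norm (e 0)"
proof -
  \<comment> \<open>The squared norm is used because it stays differentiable where \<open>e\<close>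
    vanishes, unlike the norm itself. The bracket in \<open>g'\<close> below is exactly the quantity
    that \<open>dissipative\<close> makes nonpositive.\<close>
  define g where "g s = exp (2 * c * s) * (e s \<bullet> e s)" for s
  define g' where "g' s = 2 * exp (2 * c * s) * (c * (e s \<bullet> e s) + e s \<bullet> e' s)" for s
  have g_deriv: "(g has_real_derivative g' s) (at s within {0..})" if "s \<ge> 0" for s
  proof -
    have "((\<lambda>s. e s \<bullet> e s) has_real_derivative 2 * (e s \<bullet> e' s)) (at s within {0..})"
      using bounded_bilinear.has_vector_derivative[OF bounded_bilinear_inner deriv[OF that] deriv[OF that]]
      by (simp add: has_real_derivative_iff_has_vector_derivative inner_commute)
    then show ?thesis
      unfolding g_def g'_def by (auto intro!: derivative_eq_intros simp: algebra_simps)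
  qed
  have "g t \<le> g 0"
  proof (rule DERIV_nonpos_imp_decreasing_open[OF \<open>t \<ge> 0\<close>])
    fix s :: real assume "0 < s" "s < t"
    \<comment> \<open>At 0 only a one-sided derivative is available. An interior point has the open
      neighbourhood \<open>{0<..}\<close>, where it becomes two-sided; continuity on
      \<open>{0..t}\<close> then takes care of the endpoints.\<close>
    then have "(g has_real_derivative g' s) (at s)"
      using DERIV_subset[OF g_deriv, of s "{0<..}"] at_within_open[of s "{0<..}"]
      by (simp add: subset_eq)
    moreover have "g' s \<le> 0"
      using dissipative[of s] \<open>0 < s\<close>
      by (simp add: g'_def mult_le_0_iff power2_norm_eq_inner)
    ultimately show "\<exists>d. (g has_real_derivative d) (at s) \<and> d \<le> 0"
      by blast
  next
    show "continuous_on {0..t} g"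
      by (rule continuous_on_subset[OF DERIV_continuous_on[OF g_deriv]]) auto
  qed
  \<comment> \<open>Since \<open>exp (2 * c * t)\<close> is the square of
    \<open>exp (c * t)\<close>, the inequality \<open>g t \<le> g 0\<close> compares two squares,
    and roots can be taken.\<close>
  then have "(exp (c * t) * norm (e t))\<^sup>2 \<le> (norm (e 0))\<^sup>2"
    by (simp add: g_def power_mult_distrib power2_norm_eq_inner mult.assoc flip: exp_double)
  then have "exp (c * t) * norm (e t) \<le> norm (e 0)"
    by (rule power2_le_imp_le) simp
  then show ?thesis
    by (simp add: exp_minus field_simps)
qed

lemma positive_definite_flow_tendsto:
  fixes B :: "real^'m^'m" and h :: "real \<Rightarrow> real^'m"
  assumes "positive_definite B"
    and deriv: "\<And>t. t \<ge> 0 \<Longrightarrow> (h has_vector_derivative B *v (Y - h t)) (at t within {0..})"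
  shows "(h \<longlongrightarrow> Y) at_top"
proof -
  obtain c where "c > 0" and coercive: "\<And>v. c * (norm v)\<^sup>2 \<le> v \<bullet> (B *v v)"
    using positive_definite_coercive[OF assms(1)] by metis
  have "norm (h t - Y) \<le> exp (- c * t) * norm (h 0 - Y)" if "t \<ge> 0" for t
  proof (rule dissipative_flow_norm_le[OF _ _ that])
    fix s :: real assume "s \<ge> 0"
    then show "((\<lambda>t. h t - Y) has_vector_derivative B *v (Y - h s)) (at s within {0..})"
      using deriv by (auto intro!: derivative_eq_intros)
    \<comment> \<open>The error \<open>e = h s - Y\<close> satisfies
      \<open>B *v (Y - h s) = - (B *v e)\<close>, so this is coercivity at \<open>e\<close> with the
      sign reversed.\<close>
    show "(h s - Y) \<bullet> (B *v (Y - h s)) \<le> - c * (norm (h s - Y))\<^sup>2"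
      using coercive[of "h s - Y"] by (simp add: matrix_vector_mult_diff_distrib inner_diff_right)
  qed
  then have "\<forall>\<^sub>F t in at_top. norm (h t - Y) \<le> exp (- c * t) * norm (h 0 - Y)"
    by (auto intro: eventually_at_top_linorderI[of 0])
  moreover have "((\<lambda>t. exp (- c * t) * norm (h 0 - Y)) \<longlongrightarrow> 0) at_top"
    using \<open>c > 0\<close> by real_asymp
  ultimately have "((\<lambda>t. h t - Y) \<longlongrightarrow> 0) at_top"
    by (rule Lim_null_comparison)
  then show ?thesis
    by (rule LIM_zero_cancel)
qed

theorem theorem1p3:
  fixes x :: "'m::finite \<Rightarrow> real^'d"
    and y :: "'m \<Rightarrow> real"
    and Yhat :: "real^'m"
    and \<sigma> :: "real \<Rightarrow> real"
    and \<alpha> :: real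
    and \<mu>0 :: "(real \<times> (real^'d)) measure"
    and A :: "real^'m^'m"
    and Q :: "'q measure"
    and C :: "nat \<Rightarrow> 'q \<Rightarrow> real"
    and W :: "nat \<Rightarrow> 'q \<Rightarrow> real^'d"
    and P :: "'w measure"
    and G :: "'w \<Rightarrow> real^'m"
    and h :: "'w \<Rightarrow> real \<Rightarrow> real^'m"
  assumes "Yhat = (\<chi> i. y i)"
    and "C2_bounded \<sigma>"
    and "\<alpha> > 0"
    and "prob_space \<mu>0" and "sets \<mu>0 = sets borel"
    and "(\<integral>z. z \<partial>\<mu>0) = 0"
    and "compact (measure_support (distr \<mu>0 borel fst))"
    and "integrable \<mu>0 (\<lambda>(c, w). norm w)"
    and "A = kernel_matrix \<alpha> \<sigma> \<mu>0 x"
    and "prob_space Q"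
    and "prob_space.indep_vars Q (\<lambda>_. borel) (\<lambda>i q. (C i q, W i q)) UNIV"
    and "\<And>i. distr Q borel (\<lambda>q. (C i q, W i q)) = \<mu>0"
    and "\<And>i. independent_variables Q (C i) (W i)"
    and "prob_space P"
    and "gaussian_vector P G"
    and "weakly_converges (\<lambda>N. distr Q borel (initial_output \<sigma> x C W N)) (distr P borel G)"
    and "\<And>\<omega>. \<omega> \<in> space P \<Longrightarrow> h \<omega> 0 = G \<omega>"
    and "\<And>\<omega> t. \<omega> \<in> space P \<Longrightarrow> t \<ge> 0 \<Longrightarrow>
           (h \<omega> has_vector_derivative A *v (Yhat - h \<omega> t)) (at t within {0..})"
    and "positive_definite A"
  shows "\<forall>\<omega>\<in>space P. (h \<omega> \<longlongrightarrow> Yhat) at_top"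
  \<comment> \<open>The convergence is pathwise: for each fixed \<omega>, \<open>assms(18)\<close>
    is the deterministic flow equation for \<open>h \<omega>\<close>.\<close>
  using positive_definite_flow_tendsto[OF \<open>positive_definite A\<close>] assms(18) by simp

end
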